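(* Let $A:\mathbb{R}^N\to\mathbb{R}^N$ be a (measurable) locally bounded function. Let $\Omega\subset\mathbb{R}^N$ be an open set and $\{u_k\}_{k\in\mathbb{N}}\subset BV_A(\Omega)$ a sequence converging locally in $L^1(\Omega)$ (i.e. in $L^1_{\mathrm{loc}}(\Omega,\mathbb{C})$) to a function $u$. Then $$\liminf_{k\to\infty}|Du_k|_A(\Omega)\ge|Du|_A(\Omega).$$
   Context: For $u\in L^1_{\mathrm{loc}}(\Omega,\mathbb{C})$, let $$C_{1,A,u}(\Omega):=\sup\Big\{\int_\Omega \Re u\,\mathrm{div}\,\varphi-A\cdot\varphi\,\Im u\,dx : \varphi\in C_c^\infty(\Omega,\mathbb{R}^N),\ \|\varphi\|_{L^\infty(\Omega)}\le1\Big\},$$ $$C_{2,A,u}(\Omega):=\sup\Big\{\int_\Omega \Im u\,\mathrm{div}\,\varphi+A\cdot\varphi\,\Re u\,dx : \varphi\in C_c^\infty(\Omega,\mathbb{R}^N),\ \|\varphi\|_{L^\infty(\Omega)}\le1\Big\},$$ $|Du|_A(\Omega):=C_{1,A,u}(\Omega)+C_{2,A,u}(\Omega)\in[0,\infty]$, and $BV_A(\Omega):=\{u\in L^1(\Omega,\mathbb{C}):|Du|_A(\Omega)<\infty\}$. *)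

theory Defs
  imports "HOL-Analysis.Analysis" "HOL-Probability.Essential_Supremum"
begin

(* Functions on Omega are represented by total functions whose values outside Omega
   are irrelevant, except for test fields, which are extended by zero. *)

fun Ck :: "nat \<Rightarrow> ('a::real_normed_vector \<Rightarrow> 'b::real_normed_vector) \<Rightarrow> bool" where
  "Ck 0 f \<longleftrightarrow> continuous_on UNIV f"
| "Ck (Suc n) f \<longleftrightarrow>
     (\<forall>x. f differentiable (at x)) \<and> (\<forall>v. Ck n (\<lambda>x. frechet_derivative f (at x) v))"

definition smooth :: "('a::real_normed_vector \<Rightarrow> 'b::real_normed_vector) \<Rightarrow> bool" where
  "smooth f \<longleftrightarrow> (\<forall>n. Ck n f)"

(* C_c^infty(Omega, R^N) *)
definition test_fields :: "(real^'n) set \<Rightarrow> (real^'n \<Rightarrow> real^'n) set" where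
  "test_fields \<Omega> = {\<phi>. smooth \<phi> \<and>
     compact (closure {x. \<phi> x \<noteq> 0}) \<and> closure {x. \<phi> x \<noteq> 0} \<subseteq> \<Omega>}"

definition divergence :: "(real^'n \<Rightarrow> real^'n) \<Rightarrow> real^'n \<Rightarrow> real" where
  "divergence \<phi> x = (\<Sum>i\<in>UNIV. frechet_derivative \<phi> (at x) (axis i 1) $ i)"

definition unit_test_fields :: "(real^'n) set \<Rightarrow> (real^'n \<Rightarrow> real^'n) set" where
  "unit_test_fields \<Omega> =
     {\<phi> \<in> test_fields \<Omega>. esssup (lebesgue_on \<Omega>) (\<lambda>x. ereal (norm (\<phi> x))) \<le> 1}"

definition L1 :: "(real^'n) set \<Rightarrow> (real^'n \<Rightarrow> complex) set" where
  "L1 \<Omega> = {u. set_integrable lebesgue \<Omega> u}"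

definition L1_loc :: "(real^'n) set \<Rightarrow> (real^'n \<Rightarrow> complex) set" where
  "L1_loc \<Omega> = {u. \<forall>K. compact K \<and> K \<subseteq> \<Omega> \<longrightarrow> set_integrable lebesgue K u}"

(* Meaningful only when all functions involved belong to L1_loc Omega, since the
   Lebesgue integral of a non-integrable function is 0 by convention. *)
definition tendsto_L1_loc ::
  "(real^'n) set \<Rightarrow> (nat \<Rightarrow> real^'n \<Rightarrow> complex) \<Rightarrow> (real^'n \<Rightarrow> complex) \<Rightarrow> bool" where
  "tendsto_L1_loc \<Omega> u v \<longleftrightarrow> (\<forall>K. compact K \<and> K \<subseteq> \<Omega> \<longrightarrow>
     (\<lambda>k. LINT x:K|lebesgue. norm (u k x - v x)) \<longlonglongrightarrow> 0)"

definition locally_bounded :: "(real^'n \<Rightarrow> real^'n) \<Rightarrow> bool" where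
  "locally_bounded A \<longleftrightarrow> (\<forall>x. \<exists>r>0. bounded (A ` ball x r))"

definition C1A :: "(real^'n \<Rightarrow> real^'n) \<Rightarrow> (real^'n \<Rightarrow> complex) \<Rightarrow> (real^'n) set \<Rightarrow> ereal" where
  "C1A A u \<Omega> = (SUP \<phi>\<in>unit_test_fields \<Omega>.
     ereal (LINT x:\<Omega>|lebesgue. Re (u x) * divergence \<phi> x - (A x \<bullet> \<phi> x) * Im (u x)))"

definition C2A :: "(real^'n \<Rightarrow> real^'n) \<Rightarrow> (real^'n \<Rightarrow> complex) \<Rightarrow> (real^'n) set \<Rightarrow> ereal" where
  "C2A A u \<Omega> = (SUP \<phi>\<in>unit_test_fields \<Omega>.
     ereal (LINT x:\<Omega>|lebesgue. Im (u x) * divergence \<phi> x + (A x \<bullet> \<phi> x) * Re (u x)))"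

definition magnetic_variation ::
  "(real^'n \<Rightarrow> real^'n) \<Rightarrow> (real^'n \<Rightarrow> complex) \<Rightarrow> (real^'n) set \<Rightarrow> ereal" where
  "magnetic_variation A u \<Omega> = C1A A u \<Omega> + C2A A u \<Omega>"

definition BV_A :: "(real^'n \<Rightarrow> real^'n) \<Rightarrow> (real^'n) set \<Rightarrow> (real^'n \<Rightarrow> complex) set" where
  "BV_A A \<Omega> = {u \<in> L1 \<Omega>. magnetic_variation A u \<Omega> < \<infinity>}"

end

theory Submission imports Defs begin

text \<open>For a fixed test field \<open>\<phi>\<close> put \<open>h = div \<phi> + \<i> (A \<bullet> \<phi>)\<close>; then the functionals in the
  definitions of \<open>C\<^sub>1\<close> and \<open>C\<^sub>2\<close> are the real and imaginary part of \<open>\<integral> u h\<close>. As \<open>h\<close> is bounded with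
  compact support in \<open>\<Omega>\<close>, this is continuous in \<open>u\<close> for local \<open>L\<^sup>1\<close> convergence, and a supremum of
  continuous functionals is lower semicontinuous.\<close>

text \<open>By compactness finitely many of the balls on which \<open>A\<close> is bounded already
  cover \<open>K\<close>, and a finite union of bounded sets is bounded.\<close>

lemma locally_bounded_imp_bounded_image:
  assumes "locally_bounded A" "compact K"
  shows "bounded (A ` K)"
proof -
  obtain r where r: "\<And>x. r x > 0" "\<And>x. bounded (A ` ball x (r x))"
    using assms(1) unfolding locally_bounded_def by metis
  have "K \<subseteq> (\<Union>x\<in>K. ball x (r x))" using r(1) by auto
  then obtain C where C: "C \<subseteq> K" "finite C" "K \<subseteq> (\<Union>x\<in>C. ball x (r x))"
    using compactE_image[OF assms(2), of K "\<lambda>x. ball x (r x)"] by auto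
  have "bounded (\<Union>x\<in>C. A ` ball x (r x))" using C(2) r(2) by blast
  moreover have "A ` K \<subseteq> (\<Union>x\<in>C. A ` ball x (r x))" using C(3) by blast
  ultimately show ?thesis by (rule bounded_subset)
qed

text \<open>The complement of the closed support is an open neighbourhood of \<open>x\<close> on
  which \<open>f\<close> coincides with the zero function.\<close>

lemma frechet_derivative_eq_0_off_support:
  assumes "x \<notin> closure {x. f x \<noteq> 0}"
  shows "frechet_derivative f (at x) = (\<lambda>v. 0)"
proof -
  have "((\<lambda>x. 0) has_derivative (\<lambda>v. 0)) (at x)" by simp
  then have "(f has_derivative (\<lambda>v. 0)) (at x)"
    by (rule has_derivative_transform_within_open[where s = "- closure {x. f x \<noteq> 0}"])
      (use assms closure_subset[of "{x. f x \<noteq> 0}"] in auto)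
  then show ?thesis by (rule frechet_derivative_at[symmetric])
qed

lemma smooth_imp_continuous_on:
  "smooth f \<Longrightarrow> continuous_on UNIV f"
  unfolding smooth_def using Ck.simps(1) by blast

text \<open>The divergence is a finite sum of components of directional derivatives, and
  \<open>Ck (Suc 0)\<close> makes each of these continuous.\<close>

lemma smooth_imp_continuous_on_divergence:
  assumes "smooth f"
  shows "continuous_on UNIV (divergence f)"
proof -
  have "Ck (Suc 0) f" using assms unfolding smooth_def by blast
  then have "continuous_on UNIV (\<lambda>x. frechet_derivative f (at x) v)" for v by simp
  then show ?thesis unfolding divergence_def[abs_def] by (intro continuous_intros)
qed

lemma norm_mult_right_le:
  fixes a b :: "'a::real_normed_algebra"
  assumes "norm b \<le> M"
  shows "norm (a * b) \<le> M * norm a"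
  using norm_mult_ineq[of a b] mult_left_mono[OF assms norm_ge_zero[of a]]
  by (simp add: mult.commute)

text \<open>Measurability of \<open>w\<close> is known only on \<open>K\<close>. Since
  \<open>h\<close> vanishes off \<open>K\<close>, the product on \<Omega> equals \<open>h\<close>
  times the cut-off of \<open>w\<close> to \<open>K\<close>, which is integrable and is only scaled
  by a bounded factor.\<close>

lemma set_integrable_mult_bounded_support:
  fixes w h :: "real^'n \<Rightarrow> complex"
  assumes w: "set_integrable lebesgue K w"
    and h: "h \<in> borel_measurable lebesgue" "\<And>x. norm (h x) \<le> M" "\<And>x. x \<notin> K \<Longrightarrow> h x = 0"
    and K: "K \<subseteq> \<Omega>"
  shows "set_integrable lebesgue \<Omega> (\<lambda>x. w x * h x)"
proof -
  have "integrable lebesgue (\<lambda>x. (indicator K x *\<^sub>R w x) * h x)"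
  proof (rule Bochner_Integration.integrable_bound)
    show "integrable lebesgue (\<lambda>x. M *\<^sub>R (indicator K x *\<^sub>R w x))"
      using w unfolding set_integrable_def by (intro integrable_scaleR_right)
    show "(\<lambda>x. (indicator K x *\<^sub>R w x) * h x) \<in> borel_measurable lebesgue"
      using w h(1) unfolding set_integrable_def by measurable
    show "AE x in lebesgue. norm ((indicator K x *\<^sub>R w x) * h x)
        \<le> norm (M *\<^sub>R (indicator K x *\<^sub>R w x))"
    proof (rule AE_I2)
      fix x
      \<comment> \<open>The absolute value of \<open>M\<close> appears because the dominating
        function enters through its norm.\<close>
      have "norm (w x * h x) \<le> \<bar>M\<bar> * norm (w x)"
        using h(2)[of x] by (intro norm_mult_right_le) simp
      then show "norm ((indicator K x *\<^sub>R w x) * h x) \<le> norm (M *\<^sub>R (indicator K x *\<^sub>R w x))"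
        by (simp add: indicator_def)
    qed
  qed
  moreover have "(indicator K x *\<^sub>R w x) * h x = indicator \<Omega> x *\<^sub>R (w x * h x)" for x
    using h(3)[of x] K by (auto simp: indicator_def)
  ultimately show ?thesis unfolding set_integrable_def by (simp only:)
qed

text \<open>Pairing with \<open>h\<close> is Lipschitz: the two integrals differ by at most
  \<open>M\<close> times the distance of \<open>u k\<close> and \<open>v\<close> in L1 of
  \<open>K\<close>, which tends to 0.\<close>

lemma tendsto_integral_mult_bounded_support:
  fixes u :: "nat \<Rightarrow> real^'n \<Rightarrow> complex" and v h :: "real^'n \<Rightarrow> complex"
  assumes u: "\<And>k. set_integrable lebesgue K (u k)" and v: "set_integrable lebesgue K v"
    and lim: "(\<lambda>k. LINT x:K|lebesgue. norm (u k x - v x)) \<longlonglongrightarrow> 0"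
    and h: "h \<in> borel_measurable lebesgue" "\<And>x. norm (h x) \<le> M" "\<And>x. x \<notin> K \<Longrightarrow> h x = 0"
    and K: "K \<subseteq> \<Omega>"
  shows "(\<lambda>k. LINT x:\<Omega>|lebesgue. u k x * h x) \<longlonglongrightarrow> (LINT x:\<Omega>|lebesgue. v x * h x)"
proof -
  \<comment> \<open>The open premise is filled below by \<open>u k\<close>, by \<open>v\<close> and
    by their difference.\<close>
  note int = set_integrable_mult_bounded_support[OF _ h K]
  have bound: "norm ((LINT x:\<Omega>|lebesgue. u k x * h x) - (LINT x:\<Omega>|lebesgue. v x * h x))
      \<le> M * (LINT x:K|lebesgue. norm (u k x - v x))" for k
  proof -
    have uv: "set_integrable lebesgue K (\<lambda>x. u k x - v x)"
      using u v by (rule set_integral_diff)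
    have "(LINT x:\<Omega>|lebesgue. u k x * h x) - (LINT x:\<Omega>|lebesgue. v x * h x)
        = (LINT x:\<Omega>|lebesgue. (u k x - v x) * h x)"
      using int[OF u[of k]] int[OF v] by (simp add: left_diff_distrib)
    also have "norm \<dots> \<le> (LINT x:\<Omega>|lebesgue. norm ((u k x - v x) * h x))"
      using int[OF uv] by (rule set_integral_norm_bound)
    also have "\<dots> \<le> (LINT x|lebesgue. M * (indicator K x *\<^sub>R norm (u k x - v x)))"
      unfolding set_lebesgue_integral_def
    proof (rule integral_mono)
      show "integrable lebesgue (\<lambda>x. indicator \<Omega> x *\<^sub>R norm ((u k x - v x) * h x))"
        using set_integrable_norm[OF int[OF uv]] unfolding set_integrable_def .
      show "integrable lebesgue (\<lambda>x. M * (indicator K x *\<^sub>R norm (u k x - v x)))"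
        using set_integrable_norm[OF uv] unfolding set_integrable_def by simp
      \<comment> \<open>On \<open>K\<close> both indicators are 1 and the bound on \<open>h\<close>
        applies; off \<open>K\<close> both sides are 0.\<close>
      show "indicator \<Omega> x *\<^sub>R norm ((u k x - v x) * h x)
          \<le> M * (indicator K x *\<^sub>R norm (u k x - v x))" for x
        using norm_mult_right_le[OF h(2)[of x], of "u k x - v x"] h(3)[of x] K
        by (cases "x \<in> K") (simp_all add: subset_iff)
    qed
    also have "\<dots> = M * (LINT x:K|lebesgue. norm (u k x - v x))"
      unfolding set_lebesgue_integral_def by simp
    finally show ?thesis .
  qed
  have "(\<lambda>k. M * (LINT x:K|lebesgue. norm (u k x - v x))) \<longlonglongrightarrow> 0"
    using tendsto_mult_right_zero[OF lim] by simp
  then have "(\<lambda>k. (LINT x:\<Omega>|lebesgue. u k x * h x) - (LINT x:\<Omega>|lebesgue. v x * h x)) \<longlonglongrightarrow> 0"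
    by (rule Lim_null_comparison[OF always_eventually, OF allI, OF bound])
  then show ?thesis by (rule LIM_zero_cancel)
qed

text \<open>This is the function \<open>h\<close> of the introductory remark, for the test field
  \<open>\<phi>\<close>.\<close>

definition magnetic_multiplier ::
  "(real^'n \<Rightarrow> real^'n) \<Rightarrow> (real^'n \<Rightarrow> real^'n) \<Rightarrow> real^'n \<Rightarrow> complex" where
  "magnetic_multiplier A \<phi> x = Complex (divergence \<phi> x) (A x \<bullet> \<phi> x)"

text \<open>Take for \<open>K\<close> the support of \<open>\<phi>\<close>. On this compact set
  \<open>\<phi>\<close> and its divergence are bounded by continuity, and \<open>A\<close> is
  bounded because it is locally bounded.\<close>

lemma magnetic_multiplier_bounded_support:
  assumes A: "A \<in> borel_measurable lebesgue" "locally_bounded A"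
    and \<phi>: "\<phi> \<in> test_fields \<Omega>"
  obtains K M where "compact K" "K \<subseteq> \<Omega>" "magnetic_multiplier A \<phi> \<in> borel_measurable lebesgue"
    "\<And>x. norm (magnetic_multiplier A \<phi> x) \<le> M" "\<And>x. x \<notin> K \<Longrightarrow> magnetic_multiplier A \<phi> x = 0"
proof -
  define K where "K = closure {x. \<phi> x \<noteq> 0}"
  have sm: "smooth \<phi>" and K: "compact K" "K \<subseteq> \<Omega>"
    using \<phi> unfolding test_fields_def K_def by auto
  note cont = smooth_imp_continuous_on[OF sm] smooth_imp_continuous_on_divergence[OF sm]
  have "\<phi> \<in> borel_measurable lebesgue" "divergence \<phi> \<in> borel_measurable lebesgue"
    using cont by (auto intro!: measurable_completion borel_measurable_continuous_onI)
  then have meas: "magnetic_multiplier A \<phi> \<in> borel_measurable lebesgue"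
    using A(1) unfolding magnetic_multiplier_def[abs_def] Complex_eq by measurable
  have zero: "magnetic_multiplier A \<phi> x = 0" if "x \<notin> K" for x
  proof -
    have "\<phi> x = 0" using that closure_subset[of "{x. \<phi> x \<noteq> 0}"] unfolding K_def by auto
    then show ?thesis
      using frechet_derivative_eq_0_off_support[of x \<phi>] that
      unfolding magnetic_multiplier_def divergence_def K_def by (simp add: complex_eq_iff)
  qed
  have bdd_image: "bounded (f ` K)" if "continuous_on UNIV f" for f :: "_ \<Rightarrow> 'b::real_normed_vector"
    using K(1) that compact_continuous_image compact_imp_bounded continuous_on_subset
    by (metis subset_UNIV)
  obtain a where a: "\<And>x. x \<in> K \<Longrightarrow> norm (A x) \<le> a"
    using locally_bounded_imp_bounded_image[OF A(2) K(1)] unfolding bounded_iff by auto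
  obtain b where b: "\<And>x. x \<in> K \<Longrightarrow> norm (\<phi> x) \<le> b"
    using bdd_image[OF cont(1)] unfolding bounded_iff by auto
  obtain d where d: "\<And>x. x \<in> K \<Longrightarrow> \<bar>divergence \<phi> x\<bar> \<le> d"
    using bdd_image[OF cont(2)] unfolding bounded_iff by auto
  \<comment> \<open>The maximum with 0 covers the points off \<open>K\<close>: if \<open>K\<close>
    is empty, nothing forces \<open>a\<close>, \<open>b\<close> and \<open>d\<close> to be
    nonnegative.\<close>
  have "norm (magnetic_multiplier A \<phi> x) \<le> max 0 (d + a * b)" for x
  proof (cases "x \<in> K")
    case True
    have "norm (magnetic_multiplier A \<phi> x) \<le> \<bar>divergence \<phi> x\<bar> + \<bar>A x \<bullet> \<phi> x\<bar>"
      unfolding magnetic_multiplier_def by (metis cmod_le complex.sel)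
    also have "\<bar>A x \<bullet> \<phi> x\<bar> \<le> norm (A x) * norm (\<phi> x)" by (rule Cauchy_Schwarz_ineq2)
    also have "\<dots> \<le> a * b"
      using a[OF True] b[OF True] by (intro mult_mono) (auto intro: order_trans[OF norm_ge_zero])
    finally show ?thesis using d[OF True] by simp
  qed (simp add: zero)
  then show thesis using that K meas zero by blast
qed

text \<open>Local convergence suffices because a fixed test field only sees the single compact set
  \<open>K\<close> that carries its multiplier.\<close>

lemma tendsto_integral_magnetic_multiplier:
  assumes A: "A \<in> borel_measurable lebesgue" "locally_bounded A"
    and u: "\<And>k. u k \<in> L1_loc \<Omega>" and v: "v \<in> L1_loc \<Omega>" and lim: "tendsto_L1_loc \<Omega> u v"
    and \<phi>: "\<phi> \<in> test_fields \<Omega>"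
  shows "(\<lambda>k. LINT x:\<Omega>|lebesgue. u k x * magnetic_multiplier A \<phi> x)
    \<longlonglongrightarrow> (LINT x:\<Omega>|lebesgue. v x * magnetic_multiplier A \<phi> x)"
proof -
  obtain K M where K: "compact K" "K \<subseteq> \<Omega>"
    and h: "magnetic_multiplier A \<phi> \<in> borel_measurable lebesgue"
      "\<And>x. norm (magnetic_multiplier A \<phi> x) \<le> M" "\<And>x. x \<notin> K \<Longrightarrow> magnetic_multiplier A \<phi> x = 0"
    using magnetic_multiplier_bounded_support[OF A \<phi>] by metis
  show ?thesis
    using u v lim K unfolding L1_loc_def tendsto_L1_loc_def
    by (intro tendsto_integral_mult_bounded_support[OF _ _ _ h K(2)]) auto
qed

text \<open>The integrands agree pointwise by expanding the complex product. Taking real and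
  imaginary parts out of the integral requires integrability, which local integrability of
  \<open>w\<close> and the compact support of the multiplier provide.\<close>

lemma magnetic_integrals_eq:
  assumes A: "A \<in> borel_measurable lebesgue" "locally_bounded A"
    and w: "w \<in> L1_loc \<Omega>" and \<phi>: "\<phi> \<in> test_fields \<Omega>"
  shows "(LINT x:\<Omega>|lebesgue. Re (w x) * divergence \<phi> x - (A x \<bullet> \<phi> x) * Im (w x))
      = Re (LINT x:\<Omega>|lebesgue. w x * magnetic_multiplier A \<phi> x)" (is ?R)
    and "(LINT x:\<Omega>|lebesgue. Im (w x) * divergence \<phi> x + (A x \<bullet> \<phi> x) * Re (w x))
      = Im (LINT x:\<Omega>|lebesgue. w x * magnetic_multiplier A \<phi> x)" (is ?I)
proof -
  obtain K M where K: "compact K" "K \<subseteq> \<Omega>"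
    and h: "magnetic_multiplier A \<phi> \<in> borel_measurable lebesgue"
      "\<And>x. norm (magnetic_multiplier A \<phi> x) \<le> M" "\<And>x. x \<notin> K \<Longrightarrow> magnetic_multiplier A \<phi> x = 0"
    using magnetic_multiplier_bounded_support[OF A \<phi>] by metis
  have "set_integrable lebesgue K w" using w K unfolding L1_loc_def by auto
  from set_integrable_mult_bounded_support[OF this h K(2)]
  have int: "integrable lebesgue (\<lambda>x. indicator \<Omega> x *\<^sub>R (w x * magnetic_multiplier A \<phi> x))"
    unfolding set_integrable_def .
  show ?R ?I
    unfolding set_lebesgue_integral_def integral_Re[OF int, symmetric] integral_Im[OF int, symmetric]
    by (simp_all add: magnetic_multiplier_def algebra_simps)
qed

lemma L1_subset_L1_loc: "L1 \<Omega> \<subseteq> L1_loc \<Omega>"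
proof
  fix w assume "w \<in> L1 \<Omega>"
  then show "w \<in> L1_loc \<Omega>"
    unfolding L1_def L1_loc_def
    by (auto intro!: set_integrable_subset[of lebesgue \<Omega> w] sets_completionI_sets borel_compact)
qed

text \<open>For fixed \<open>i\<close>, the limit \<open>G i\<close> is the lower limit of
  \<open>F i k\<close>, and each \<open>F i k\<close> lies below the supremum over \<open>S\<close>.
  Then take the supremum over \<open>i\<close>.\<close>

lemma Liminf_SUP_ge:
  fixes F :: "'a \<Rightarrow> nat \<Rightarrow> real" and G :: "'a \<Rightarrow> real"
  assumes "\<And>i. i \<in> S \<Longrightarrow> (\<lambda>k. F i k) \<longlonglongrightarrow> G i"
  shows "(SUP i\<in>S. ereal (G i)) \<le> liminf (\<lambda>k. SUP i\<in>S. ereal (F i k))"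
proof (rule SUP_least)
  fix i assume i: "i \<in> S"
  have "(\<lambda>k. ereal (F i k)) \<longlonglongrightarrow> ereal (G i)" using assms[OF i] by simp
  then have "ereal (G i) = liminf (\<lambda>k. ereal (F i k))"
    by (intro lim_imp_Liminf[symmetric]) auto
  also have "\<dots> \<le> liminf (\<lambda>k. SUP i\<in>S. ereal (F i k))"
    by (intro Liminf_mono always_eventually allI SUP_upper i)
  finally show "ereal (G i) \<le> liminf (\<lambda>k. SUP i\<in>S. ereal (F i k))" .
qed

lemma Ck_zero: "Ck n (\<lambda>x. 0)"
  by (induction n) (auto simp: frechet_derivative_const)

lemma zero_in_unit_test_fields: "(\<lambda>x. 0) \<in> unit_test_fields \<Omega>"
proof -
  have "esssup (lebesgue_on \<Omega>) (\<lambda>x. ereal (norm (0::real^'n))) \<le> 1"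
    by (rule esssup_I) auto
  then show ?thesis
    unfolding unit_test_fields_def test_fields_def smooth_def by (simp add: Ck_zero)
qed

text \<open>The zero field is admissible and gives the value 0. This serves to keep sums of extended
  reals away from \<infinity> - \<infinity>.\<close>

lemma C1A_C2A_nonneg: "0 \<le> C1A A w \<Omega>" "0 \<le> C2A A w \<Omega>"
proof -
  have div: "divergence (\<lambda>x. 0) x = 0" for x :: "real^'n"
    unfolding divergence_def by (simp add: frechet_derivative_const)
  then show "0 \<le> C1A A w \<Omega>" "0 \<le> C2A A w \<Omega>"
    unfolding C1A_def C2A_def
    by (auto simp: div intro!: SUP_upper2[OF zero_in_unit_test_fields])
qed

theorem lemma3p7:
  fixes A :: "real^'n \<Rightarrow> real^'n"
    and \<Omega> :: "(real^'n) set"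
    and u :: "nat \<Rightarrow> real^'n \<Rightarrow> complex"
    and v :: "real^'n \<Rightarrow> complex"
  assumes "A \<in> borel_measurable lebesgue"
    and "locally_bounded A"
    and "open \<Omega>"
    and "\<And>k. u k \<in> BV_A A \<Omega>"
    and "v \<in> L1_loc \<Omega>"
    and "tendsto_L1_loc \<Omega> u v"
  shows "liminf (\<lambda>k. magnetic_variation A (u k) \<Omega>) \<ge> magnetic_variation A v \<Omega>"
proof -
  have u: "u k \<in> L1_loc \<Omega>" for k
    using assms(4)[of k] L1_subset_L1_loc unfolding BV_A_def by auto
  have \<phi>: "\<phi> \<in> test_fields \<Omega>" if "\<phi> \<in> unit_test_fields \<Omega>" for \<phi>
    using that unfolding unit_test_fields_def by simp
  note eqs = magnetic_integrals_eq[OF assms(1,2)]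
  note lim = tendsto_integral_magnetic_multiplier[OF assms(1,2) u assms(5,6)]
  \<comment> \<open>For each test field both functionals become real parts of integrals against the
    multiplier, and convergence passes to real parts; \<open>C2\<close> does the same with imaginary
    parts.\<close>
  have C1: "C1A A v \<Omega> \<le> liminf (\<lambda>k. C1A A (u k) \<Omega>)"
    unfolding C1A_def
    by (rule Liminf_SUP_ge) (simp add: eqs u assms(5) \<phi> tendsto_Re[OF lim])
  have C2: "C2A A v \<Omega> \<le> liminf (\<lambda>k. C2A A (u k) \<Omega>)"
    unfolding C2A_def
    by (rule Liminf_SUP_ge) (simp add: eqs u assms(5) \<phi> tendsto_Im[OF lim])
  have "magnetic_variation A v \<Omega> \<le> liminf (\<lambda>k. C1A A (u k) \<Omega>) + liminf (\<lambda>k. C2A A (u k) \<Omega>)"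
    unfolding magnetic_variation_def using C1 C2 by (rule add_mono)
  also have "\<dots> \<le> liminf (\<lambda>k. magnetic_variation A (u k) \<Omega>)"
    unfolding magnetic_variation_def
    \<comment> \<open>Superadditivity of the lower limit excludes one lower limit being \<infinity>
      and the other -\<infinity>. By \<open>C1\<close>, \<open>C2\<close> and nonnegativity for
      \<open>v\<close>, both are at least 0.\<close>
    by (rule ereal_liminf_add_mono)
      (use C1 C2 C1A_C2A_nonneg[of A v \<Omega>] in auto)
  finally show ?thesis .
qed

end
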